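(* Both of the following identities hold: $$\sum_{n=1}^{\infty}\frac{C_n(H_{2n}-H_n)}{4^{2n}}\binom{2n+2}{n+1}=\frac{16}{\pi}\psi,\qquad \text{where } \psi = 2G+\pi-2-\ln 2-\pi \ln 2,$$ $$\sum_{n=1}^{\infty} \frac{C_nH_{2n}}{16^n}\binom{2n}{n}=\frac{2}{\pi}\psi^*,\qquad \text{where } \psi^*= 2+\pi -2\ln 8.$$
   Context: $H_n=\sum_{k=1}^n \frac1k$ is the $n$-th harmonic number. $C_n=\frac{1}{n+1}\binom{2n}{n}$ is the $n$-th Catalan number. $G=\sum_{k=0}^{\infty}\frac{(-1)^k}{(2k+1)^2}$ is Catalan's constant. *)

theory Defs
  imports "HOL-Analysis.Analysis"
begin

definition catalan_number :: "nat \<Rightarrow> real" where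
  "catalan_number n = 1 / (real n + 1) * real ((2 * n) choose n)"

definition catalan_constant :: real where
  "catalan_constant = (\<Sum>k. (-1) ^ k / (2 * real k + 1)\<^sup>2)"

end

theory Submission
  imports Defs "HOL-Real_Asymp.Real_Asymp"
begin

text \<open>
  Write \<open>w n\<close> for the central binomial coefficient \<open>(2 n choose n) / 4 ^ n\<close>. Both series have terms
  of the form (rational function of \<open>n\<close>) times \<open>(w n)\<^sup>2\<close> times a harmonic factor. In both cases the
  part without the harmonic factor is the forward difference of a linear polynomial in \<open>n\<close> times
  \<open>(w n)\<^sup>2\<close>: for the second series \<open>(w n)\<^sup>2 / (n + 1)\<close> is the difference of \<open>4 n (w n)\<^sup>2\<close>, and for
  the first \<open>2 (2 n + 1) (w n)\<^sup>2 / (n + 1)\<^sup>2\<close> is the difference of \<open>- (16 n + 8) (w n)\<^sup>2\<close>. Summation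
  by parts therefore removes the harmonic numbers and leaves, up to terms in closed form, one sum
  each:

    \<^item> \<open>\<Sum>n<N. (w n)\<^sup>2\<close> for the second series (\<open>sum_harm_wallis_ratio_sq\<close>). It diverges
      logarithmically, and its constant term is needed.
    \<^item> \<open>\<Sum>n<N. (w (n + 1))\<^sup>2 / (n + 1)\<close> for the first (\<open>sum_harm_diff_wallis_ratio_sq\<close>). Here
      Catalan's constant enters.

  Both sums are evaluated by replacing one factor \<open>w n\<close> by Wallis' integral
  \<open>2 / \<pi> \<integral> sin\<^sup>2\<^sup>n\<close> over \<open>[0, \<pi> / 2]\<close> and summing the generating function of the other factor under
  the integral sign.

  For the divergent sum a comparison series is subtracted first. The odd Wallis integral
  \<open>\<integral> sin\<^sup>2\<^sup>n\<^sup>+\<^sup>1\<close> equals \<open>1 / ((2 n + 1) w n)\<close>, so using it instead of the even one turns \<open>(w n)\<^sup>2\<close> into the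
  elementary term \<open>2 / (\<pi> (2 n + 1))\<close>. The difference of the two integrands sums to
  \<open>(1 - sin t) / cos t = cos t / (1 + sin t)\<close>, whose integral is \<open>ln 2\<close>
  (\<open>sums_wallis_ratio_sq_minus\<close>).

  For the other sum, integrating the generating function of \<open>w\<close> gives
  \<open>\<Sum>n. w (n + 1) sin\<^sup>2\<^sup>n\<^sup>+\<^sup>2 t / (n + 1) = 2 ln 2 - 2 ln (1 + cos t)\<close>, so what remains is
  \<open>\<integral> ln (2 + 2 cos t) = 2 G\<close> over \<open>[0, \<pi> / 2]\<close> (\<open>has_integral_ln_2_plus_2cos\<close>). This is the limit
  \<open>r \<rightarrow> 1\<close> of the termwise integrated real part of \<open>2 ln (1 + r e\<^sup>i\<^sup>t)\<close>.

  The boundary terms of the summations by parts are controlled by \<open>n (w n)\<^sup>2 \<rightarrow> 1 / \<pi>\<close>, which is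
  Wallis' product, together with an \<open>O(1 / n)\<close> error bound where the factor \<open>H (2 n)\<close> grows.
\<close>

section \<open>Normalised central binomial coefficients\<close>

definition wallis_ratio :: "nat \<Rightarrow> real" where
  "wallis_ratio n = real ((2 * n) choose n) / 4 ^ n"

lemma wallis_ratio_0 [simp]: "wallis_ratio 0 = 1"
  by (simp add: wallis_ratio_def)

lemma wallis_ratio_pos: "wallis_ratio n > 0"
  by (simp add: wallis_ratio_def)

lemma wallis_ratio_Suc:
  "wallis_ratio (Suc n) = (2 * real n + 1) / (2 * real n + 2) * wallis_ratio n"
proof -
  have "real ((2 * m) choose m) = fact (2 * m) / (fact m)\<^sup>2" for m
    by (subst binomial_fact) (auto simp: power2_eq_square)
  then have w: "wallis_ratio m = fact (2 * m) / ((fact m)\<^sup>2 * 4 ^ m)" for m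
    by (simp add: wallis_ratio_def)
  show ?thesis
    unfolding w by (simp add: divide_simps power2_eq_square) (simp add: algebra_simps)
qed

text \<open>Every rational identity between sums over squared ratios reduces to this recurrence.\<close>

lemma wallis_ratio_Suc_sq:
  "(wallis_ratio (Suc n))\<^sup>2 = (2 * real n + 1)\<^sup>2 / (4 * (real n + 1)\<^sup>2) * (wallis_ratio n)\<^sup>2"
  by (simp add: wallis_ratio_Suc power2_eq_square field_simps)

lemma wallis_ratio_eq_gbinomial: "wallis_ratio n = (- 1) ^ n * ((- 1 / 2) gchoose n)"
proof (induction n)
  case (Suc n)
  have "real (Suc n) * ((- 1 / 2 :: real) gchoose Suc n) = (- 1 / 2 - real n) * ((- 1 / 2) gchoose n)"
    using gbinomial_absorb_comp[of "- 1 / 2 :: real" n] gbinomial_absorption[of n "- 1 / 2 :: real"]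
    by simp
  then have *: "((- 1 / 2 :: real) gchoose Suc n) = (- 1 / 2 - real n) * ((- 1 / 2) gchoose n) / real (Suc n)"
    by (simp add: field_simps)
  show ?case
    unfolding * wallis_ratio_Suc Suc by (simp add: divide_simps) (simp add: algebra_simps)
qed simp

lemma wallis_ratio_powser:
  assumes "\<bar>x\<bar> < 1"
  shows "(\<lambda>n. wallis_ratio n * x ^ n) sums (1 / sqrt (1 - x))"
proof -
  have "(\<lambda>n. ((- 1 / 2) gchoose n) * (- x) ^ n) sums (1 + (- x)) powr (- 1 / 2)"
    by (rule gen_binomial_real) (use assms in simp)
  moreover have "(1 + (- x)) powr (- 1 / 2) = 1 / sqrt (1 - x)"
    using assms powr_minus[of "1 - x" "1 / 2"] by (simp add: powr_half_sqrt field_simps)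
  moreover have "((- 1 / 2) gchoose n) * (- x) ^ n = wallis_ratio n * x ^ n" for n
    by (simp add: wallis_ratio_eq_gbinomial power_minus[of x])
  ultimately show ?thesis by simp
qed

lemma wallis_ratio_sin_powser:
  assumes t: "0 < t" "t < pi / 2"
  shows "(\<lambda>n. wallis_ratio n * sin t ^ (2 * n)) sums (1 / cos t)"
proof -
  have c: "cos t > 0" using t by (auto intro: cos_gt_zero)
  have "(sin t)\<^sup>2 < 1"
    using sin_cos_squared_add[of t] zero_less_power[OF c, of 2] by linarith
  moreover have "sqrt (1 - (sin t)\<^sup>2) = cos t"
    using c by (simp flip: cos_squared_eq)
  ultimately show ?thesis
    using wallis_ratio_powser[of "(sin t)\<^sup>2"] by (simp flip: power_mult)
qed

text \<open>
  Wallis' integrals. Both parities obey the reduction formula obtained by differentiating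
  \<open>- cos t * sin t ^ (k + 1)\<close>, whose boundary values vanish. The even case produces \<open>wallis_ratio\<close>
  and the odd case its reciprocal, so \<open>wallis_ratio n\<close> times the odd integral is rational. This is what
  makes the odd integrals a good comparison for the even ones.
\<close>

lemma has_integral_sin_power:
  "((\<lambda>t. sin t ^ (2 * n)) has_integral pi / 2 * wallis_ratio n) {0..pi / 2}"
  "((\<lambda>t. sin t ^ (2 * n + 1)) has_integral 1 / ((2 * real n + 1) * wallis_ratio n)) {0..pi / 2}"
proof -
  have step: "((\<lambda>t. sin t ^ (k + 2)) has_integral (real k + 1) / (real k + 2) * I) {0..pi / 2}"
    if "((\<lambda>t. sin t ^ k) has_integral I) {0..pi / 2}" for k I
  proof -
    have "((\<lambda>t. (real k + 2) * sin t ^ (k + 2) - (real k + 1) * sin t ^ k) has_integral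
        (- cos (pi / 2) * sin (pi / 2) ^ (k + 1)) - (- cos 0 * sin 0 ^ (k + 1))) {0..pi / 2}"
    proof (rule fundamental_theorem_of_calculus)
      fix t :: real
      have "sin t * sin t ^ (k + 1) - cos t * (real (k + 1) * (sin t ^ k * cos t))
          = (real k + 2) * sin t ^ (k + 2) - (real k + 1) * sin t ^ k"
      proof -
        have "sin t * (sin t * p) - cos t * ((1 + a) * (p * cos t))
            = (a + 2) * (sin t * (sin t * p)) - (a + 1) * p" for a p :: real
          using sin_cos_squared_add[of t] by algebra
        from this[of "sin t ^ k" "real k"] show ?thesis by (simp add: add_ac)
      qed
      moreover have "((\<lambda>t. - cos t * sin t ^ (k + 1)) has_real_derivative
          sin t * sin t ^ (k + 1) - cos t * (real (k + 1) * (sin t ^ k * cos t))) (at t within {0..pi / 2})"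
        by (rule derivative_eq_intros refl)+ simp
      ultimately show "((\<lambda>t. - cos t * sin t ^ (k + 1)) has_vector_derivative
          (real k + 2) * sin t ^ (k + 2) - (real k + 1) * sin t ^ k) (at t within {0..pi / 2})"
        by (simp add: has_real_derivative_iff_has_vector_derivative)
    qed simp
    from has_integral_mult_right[OF has_integral_add[OF this
        has_integral_mult_right[OF that, of "real k + 1"]], of "1 / (real k + 2)"]
    have "((\<lambda>t. 1 / (real k + 2) * ((real k + 2) * sin t ^ (k + 2))) has_integral
        1 / (real k + 2) * ((real k + 1) * I)) {0..pi / 2}"
      by simp
    moreover have "1 / (real k + 2) * ((real k + 2) * s) = s" for s
      by (simp add: field_simps)
    ultimately show ?thesis by (simp only: times_divide_eq_left mult_1)
  qed
  show "((\<lambda>t. sin t ^ (2 * n)) has_integral pi / 2 * wallis_ratio n) {0..pi / 2}"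
  proof (induction n)
    case 0
    then show ?case using has_integral_const_real[of "1 :: real" 0 "pi / 2"] by simp
  next
    case (Suc n)
    have eq: "(real (2 * n) + 1) / (real (2 * n) + 2) * (pi / 2 * wallis_ratio n) = pi / 2 * wallis_ratio (Suc n)"
      by (simp add: wallis_ratio_Suc)
    from step[OF Suc] show ?case unfolding eq by simp
  qed
  show "((\<lambda>t. sin t ^ (2 * n + 1)) has_integral 1 / ((2 * real n + 1) * wallis_ratio n)) {0..pi / 2}"
  proof (induction n)
    case 0
    have "(sin has_integral (- cos (pi / 2)) - (- cos 0)) {0..pi / 2}"
      by (rule fundamental_theorem_of_calculus)
        (auto intro!: derivative_eq_intros
          simp flip: has_real_derivative_iff_has_vector_derivative)
    then show ?case by simp
  next
    case (Suc n)
    have "(real (2 * n + 1) + 1) / (real (2 * n + 1) + 2) * (1 / ((2 * real n + 1) * wallis_ratio n))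
       = 1 / ((2 * real (Suc n) + 1) * wallis_ratio (Suc n))"
      using wallis_ratio_pos[of n]
      by (simp add: wallis_ratio_Suc divide_simps)
    with step[OF Suc] show ?case by simp
  qed
qed

section \<open>Termwise integration\<close>

text \<open>
  Convergence is required only in the open interval, because some of the series below have the wrong
  value at an endpoint: a series whose terms all carry a factor \<open>cos t\<close> sums to 0 at
  \<open>pi / 2\<close>, where the continuous function it represents elsewhere need not vanish.
\<close>

lemma sums_has_integral_dominated:
  fixes f :: "nat \<Rightarrow> real \<Rightarrow> real"
  assumes f: "\<And>n. (f n has_integral I n) {a..b}"
    and g: "(g has_integral J) {a..b}" and h: "h integrable_on {a..b}"
    and sums: "\<And>x. a < x \<Longrightarrow> x < b \<Longrightarrow> (\<lambda>n. f n x) sums g x"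
    and bound: "\<And>N x. a < x \<Longrightarrow> x < b \<Longrightarrow> \<bar>\<Sum>n<N. f n x\<bar> \<le> h x"
  shows "I sums J"
proof -
  have F: "((\<lambda>x. \<Sum>n<N. f n x) has_integral (\<Sum>n<N. I n)) {a<..<b}" for N
    using has_integral_sum[of "{..<N}" f I "{a..b}"] f by (simp add: has_integral_Icc_iff_Ioo)
  have "(\<lambda>N. integral {a<..<b} (\<lambda>x. \<Sum>n<N. f n x)) \<longlonglongrightarrow> integral {a<..<b} g"
    by (rule dominated_convergence[where h = h])
      (use F h sums bound in \<open>auto simp: integrable_on_Icc_iff_Ioo sums_def intro: has_integral_integrable\<close>)
  then show ?thesis
    using g by (simp add: integral_unique[OF F] has_integral_Icc_iff_Ioo integral_unique sums_def)
qed

lemma sums_has_integral_nonneg: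
  fixes f :: "nat \<Rightarrow> real \<Rightarrow> real"
  assumes f: "\<And>n. (f n has_integral I n) {a..b}"
    and g: "(g has_integral J) {a..b}"
    and sums: "\<And>x. a < x \<Longrightarrow> x < b \<Longrightarrow> (\<lambda>n. f n x) sums g x"
    and nonneg: "\<And>n x. a < x \<Longrightarrow> x < b \<Longrightarrow> f n x \<ge> 0"
  shows "I sums J"
proof (rule sums_has_integral_dominated[OF f g has_integral_integrable[OF g] sums])
  fix N x assume x: "a < x" "x < b"
  show "\<bar>\<Sum>n<N. f n x\<bar> \<le> g x"
    using sum_le_suminf[OF sums_summable[OF sums[OF x]], of "{..<N}"] nonneg[OF x]
      sums_unique[OF sums[OF x]] by (simp add: sum_nonneg)
qed

section \<open>The logarithmic sum\<close>

text \<open>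
  One factor \<open>wallis_ratio n\<close> is \<open>2 / pi\<close> times the integral of \<open>sin t ^ (2 * n)\<close>, and
  \<open>2 / pi / (2 * n + 1)\<close> results if \<open>sin t ^ (2 * n + 1)\<close> is taken in its place. The factor \<open>1 - sin t\<close> in the difference cancels the
  singularity \<open>1 / cos t\<close> of the generating function at \<open>pi / 2\<close>, and it is nonnegative.
\<close>

lemma sums_wallis_ratio_sq_minus:
  "(\<lambda>n. (wallis_ratio n)\<^sup>2 - 2 / pi / (2 * real n + 1)) sums (2 / pi * ln 2)"
proof -
  have "(\<lambda>n. wallis_ratio n * (pi / 2 * wallis_ratio n - 1 / ((2 * real n + 1) * wallis_ratio n)))
      sums (ln (1 + sin (pi / 2)) - ln (1 + sin 0))"
  proof (rule sums_has_integral_nonneg)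
    show "((\<lambda>t. wallis_ratio n * (sin t ^ (2 * n) - sin t ^ (2 * n + 1))) has_integral
        wallis_ratio n * (pi / 2 * wallis_ratio n - 1 / ((2 * real n + 1) * wallis_ratio n)))
        {0..pi / 2}" for n
      by (intro has_integral_mult_right has_integral_diff has_integral_sin_power)
    show "((\<lambda>t. cos t / (1 + sin t)) has_integral
        ln (1 + sin (pi / 2)) - ln (1 + sin 0)) {0..pi / 2}"
    proof (rule fundamental_theorem_of_calculus)
      fix t :: real assume "t \<in> {0..pi / 2}"
      then have "1 + sin t > 0" using sin_ge_zero[of t] by auto
      then show "((\<lambda>t. ln (1 + sin t)) has_vector_derivative cos t / (1 + sin t)) (at t within {0..pi / 2})"
        unfolding has_real_derivative_iff_has_vector_derivative [symmetric]
        by (auto intro!: derivative_eq_intros)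
    qed simp
  next
    fix t :: real assume t: "0 < t" "t < pi / 2"
    have c: "cos t > 0" and s: "sin t > 0" using t by (auto intro: cos_gt_zero sin_gt_zero)
    have "(\<lambda>n. wallis_ratio n * sin t ^ (2 * n) * (1 - sin t)) sums (1 / cos t * (1 - sin t))"
      by (rule sums_mult2[OF wallis_ratio_sin_powser[OF t]])
    moreover have "1 / cos t * (1 - sin t) = cos t / (1 + sin t)"
      using c s sin_cos_squared_add[of t] by (simp add: field_simps power2_eq_square)
    ultimately show "(\<lambda>n. wallis_ratio n * (sin t ^ (2 * n) - sin t ^ (2 * n + 1))) sums (cos t / (1 + sin t))"
      by (simp add: algebra_simps)
    show "wallis_ratio n * (sin t ^ (2 * n) - sin t ^ (2 * n + 1)) \<ge> 0" for n
      using s wallis_ratio_pos[of n] by (intro mult_nonneg_nonneg) (auto intro: mult_left_le_one_le)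
  qed
  moreover have "2 / pi * (wallis_ratio n * (pi / 2 * wallis_ratio n - 1 / ((2 * real n + 1) * wallis_ratio n)))
      = (wallis_ratio n)\<^sup>2 - 2 / pi / (2 * real n + 1)" for n
    using wallis_ratio_pos[of n] by (simp add: divide_simps) (simp add: algebra_simps power2_eq_square)
  ultimately show ?thesis
    using sums_mult[of _ "ln (1 + sin (pi / 2)) - ln (1 + sin 0)" "2 / pi"] by fastforce
qed

section \<open>The sum with Catalan's constant\<close>

text \<open>
  Differentiating in \<open>s\<close> cancels the denominators \<open>n + 1\<close> and leaves the generating function
  without its constant term; the derivative sums to
  \<open>2 * cot s * (1 / cos s - 1) = 2 * sin s / (1 + cos s)\<close>. All terms are nonnegative, so this can be
  integrated back from \<open>0\<close>.
\<close>

lemma sums_wallis_ratio_sin_powser_div: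
  assumes s: "0 < s" "s \<le> pi / 2"
  shows "(\<lambda>n. wallis_ratio (Suc n) * sin s ^ (2 * n + 2) / (real n + 1))
    sums (2 * ln 2 - 2 * ln (1 + cos s))"
proof -
  have "(\<lambda>n. wallis_ratio (Suc n) / (real n + 1) * sin s ^ (2 * n + 2)
        - wallis_ratio (Suc n) / (real n + 1) * sin 0 ^ (2 * n + 2))
      sums (- 2 * ln (1 + cos s) - (- 2 * ln (1 + cos 0)))"
  proof (rule sums_has_integral_nonneg)
    show "((\<lambda>t. 2 * wallis_ratio (Suc n) * sin t ^ (2 * n + 1) * cos t) has_integral
        (wallis_ratio (Suc n) / (real n + 1) * sin s ^ (2 * n + 2)
          - wallis_ratio (Suc n) / (real n + 1) * sin 0 ^ (2 * n + 2)))
        {0..s}" for n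
    proof (rule fundamental_theorem_of_calculus)
      fix t :: real
      show "((\<lambda>t. wallis_ratio (Suc n) / (real n + 1) * sin t ^ (2 * n + 2)) has_vector_derivative
          2 * wallis_ratio (Suc n) * sin t ^ (2 * n + 1) * cos t) (at t within {0..s})"
        unfolding has_real_derivative_iff_has_vector_derivative [symmetric]
        by (rule derivative_eq_intros refl)+ (simp add: divide_simps)
    qed (use s in simp)
    show "((\<lambda>t. 2 * sin t / (1 + cos t)) has_integral - 2 * ln (1 + cos s) - (- 2 * ln (1 + cos 0))) {0..s}"
    proof (rule fundamental_theorem_of_calculus)
      fix t :: real assume "t \<in> {0..s}"
      then have "1 + cos t > 0" using s cos_ge_zero[of t] by auto
      then show "((\<lambda>t. - 2 * ln (1 + cos t)) has_vector_derivative 2 * sin t / (1 + cos t)) (at t within {0..s})"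
        unfolding has_real_derivative_iff_has_vector_derivative [symmetric]
        by (auto intro!: derivative_eq_intros)
    qed (use s in simp)
  next
    fix t :: real assume "0 < t" "t < s"
    with s have t: "0 < t" "t < pi / 2" by auto
    have c: "cos t > 0" and sn: "sin t > 0" using t by (auto intro: cos_gt_zero sin_gt_zero)
    have "(\<lambda>n. wallis_ratio (Suc n) * sin t ^ (2 * Suc n)) sums (1 / cos t - 1)"
      using wallis_ratio_sin_powser[OF t] by (subst sums_Suc_iff) simp
    then have "(\<lambda>n. wallis_ratio (Suc n) * sin t ^ (2 * Suc n) * (2 * cos t / sin t))
        sums ((1 / cos t - 1) * (2 * cos t / sin t))"
      by (rule sums_mult2)
    moreover have "wallis_ratio (Suc n) * sin t ^ (2 * Suc n) * (2 * cos t / sin t)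
        = 2 * wallis_ratio (Suc n) * sin t ^ (2 * n + 1) * cos t" for n
      using sn by simp
    moreover have "(1 / cos t - 1) * (2 * cos t / sin t) = 2 * sin t / (1 + cos t)"
    proof -
      have "(1 - cos t) * (1 + cos t) = sin t * sin t"
        using sin_cos_squared_add[of t] by algebra
      then have "(1 - cos t) / sin t = sin t / (1 + cos t)"
        using c sn by (simp add: frac_eq_eq)
      moreover have "(1 / cos t - 1) * (2 * cos t / sin t) = 2 * ((1 - cos t) / sin t)"
        using c sn by (simp add: field_simps)
      ultimately show ?thesis by simp
    qed
    ultimately show "(\<lambda>n. 2 * wallis_ratio (Suc n) * sin t ^ (2 * n + 1) * cos t) sums (2 * sin t / (1 + cos t))"
      by simp
    show "2 * wallis_ratio (Suc n) * sin t ^ (2 * n + 1) * cos t \<ge> 0" for n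
      using c sn wallis_ratio_pos[of "Suc n"] by simp
  qed
  then show ?thesis by simp
qed

text \<open>Twice the real part of the power series of \<open>ln (1 + z)\<close> at \<open>z = r * cis t\<close>.\<close>

lemma sums_ln_one_plus_2cos:
  fixes r t :: real
  assumes "\<bar>r\<bar> < 1"
  shows "(\<lambda>k. - 2 * (- r) ^ k / real k * cos (real k * t)) sums ln (1 + 2 * r * cos t + r\<^sup>2)"
proof -
  define z where "z = rcis r t"
  have z: "cmod z < 1" using assms by (simp add: z_def)
  then have nz: "1 + z \<noteq> 0" by (metis add.inverse_unique less_irrefl norm_minus_cancel norm_one)
  have "(cmod (1 + z))\<^sup>2 = (1 + r * cos t)\<^sup>2 + (r * sin t)\<^sup>2"
    by (simp add: z_def cmod_power2)
  also have "\<dots> = 1 + 2 * r * cos t + r\<^sup>2"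
    using sin_cos_squared_add[of t] by algebra
  finally have "2 * Re (ln (1 + z)) = ln (1 + 2 * r * cos t + r\<^sup>2)"
    using nz ln_realpow[of "cmod (1 + z)" 2] by simp
  moreover have "(\<lambda>k. 2 * Re (- ((- z) ^ k) / of_nat k)) sums (2 * Re (ln (1 + z)))"
    by (intro sums_mult sums_Re Ln_series' z)
  moreover have "2 * Re (- ((- z) ^ k) / of_nat k) = - 2 * (- r) ^ k / real k * cos (real k * t)" for k
  proof -
    have "- z = rcis (- r) t" by (simp add: z_def rcis_def)
    then have "(- z) ^ k = rcis ((- r) ^ k) (real k * t)" by (simp add: DeMoivre2)
    then show ?thesis by simp
  qed
  ultimately show ?thesis by (simp only:)
qed

lemma summable_inverse_odd_sq: "summable (\<lambda>k. 1 / (2 * real k + 1)\<^sup>2)"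
proof (rule summable_comparison_test')
  show "summable (\<lambda>k. inverse (real (Suc k) ^ 2))"
    using inverse_power_summable[of 2, where 'a = real] by (subst summable_Suc_iff) simp
  show "norm (1 / (2 * real k + 1)\<^sup>2) \<le> inverse (real (Suc k) ^ 2)" for k
    by (auto simp: inverse_eq_divide intro!: divide_left_mono power_mono)
qed

text \<open>
  Integrating \<open>cos (k * t)\<close> over a quarter period gives \<open>sin (k * pi / 2) / k\<close>, which vanishes for
  even \<open>k\<close> and alternates in sign for odd \<open>k\<close>. This is how the series of Catalan's constant appears.
  For \<open>r < 1\<close> a geometric series dominates the partial sums.
\<close>

lemma integral_ln_one_plus_2cos:
  assumes r: "0 \<le> r" "r < 1"
  shows "integral {0..pi / 2} (\<lambda>t. ln (1 + 2 * r * cos t + r\<^sup>2))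
      = (\<Sum>k. 2 * ((- 1) ^ k * r ^ (2 * k + 1) / (2 * real k + 1)\<^sup>2))"
proof -
  let ?g = "\<lambda>t. ln (1 + 2 * r * cos t + r\<^sup>2)"
  let ?c = "\<lambda>k. - 2 * (- r) ^ k / real k"
  have pos: "1 + 2 * r * cos t + r\<^sup>2 > 0" if "t \<in> {0..pi / 2}" for t
    using that r cos_ge_zero[of t] by (simp add: add_pos_nonneg)
  have "continuous_on {0..pi / 2} ?g"
    using pos by (intro continuous_intros) force
  then have g: "(?g has_integral integral {0..pi / 2} ?g) {0..pi / 2}"
    by (simp add: integrable_continuous_real integrable_integral)
  have "(\<lambda>k. ?c k / real k * sin (real k * (pi / 2)) - ?c k / real k * sin (real k * 0))
      sums integral {0..pi / 2} ?g"
  proof (rule sums_has_integral_dominated[OF _ g integrable_const_ivl sums_ln_one_plus_2cos])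
    show "((\<lambda>t. ?c k * cos (real k * t)) has_integral
        (?c k / real k * sin (real k * (pi / 2)) - ?c k / real k * sin (real k * 0))) {0..pi / 2}" for k
      by (rule fundamental_theorem_of_calculus; cases "k = 0")
        (auto intro!: derivative_eq_intros simp flip: has_real_derivative_iff_has_vector_derivative)
  next
    fix N t
    have "\<bar>\<Sum>k<N. ?c k * cos (real k * t)\<bar> \<le> (\<Sum>k<N. 2 * r ^ k)"
    proof (rule order_trans[OF sum_abs sum_mono])
      fix k
      have "\<bar>?c k * cos (real k * t)\<bar> \<le> \<bar>?c k\<bar> * 1"
        unfolding abs_mult by (intro mult_left_mono) auto
      also have "\<bar>?c k\<bar> \<le> 2 * r ^ k"
        using r by (cases "k = 0") (auto simp: abs_mult power_abs divide_le_eq mult_le_cancel_left1)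
      finally show "\<bar>?c k * cos (real k * t)\<bar> \<le> 2 * r ^ k" by simp
    qed
    also have "\<dots> \<le> (\<Sum>k. 2 * r ^ k)"
      using r by (intro sum_le_suminf) (auto intro: summable_mult)
    finally show "\<bar>\<Sum>k<N. ?c k * cos (real k * t)\<bar> \<le> (\<Sum>k. 2 * r ^ k)" .
  qed (use r in auto)
  then have "(\<lambda>k. ?c k / real k * sin (real k * (pi / 2))) sums integral {0..pi / 2} ?g"
    by simp
  then have "(\<lambda>j. ?c (2 * j + 1) / real (2 * j + 1) * sin (real (2 * j + 1) * (pi / 2)))
      sums integral {0..pi / 2} ?g"
  proof (subst sums_mono_reindex[of "\<lambda>j. 2 * j + 1"])
    fix n :: nat assume "n \<notin> range (\<lambda>j. 2 * j + 1)"
    then have "even n" by (metis oddE rangeI)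
    then show "?c n / real n * sin (real n * (pi / 2)) = 0" by (auto elim!: evenE)
  qed (auto simp: strict_mono_def)
  moreover have "?c (2 * j + 1) / real (2 * j + 1) * sin (real (2 * j + 1) * (pi / 2))
      = 2 * ((- 1) ^ j * r ^ (2 * j + 1) / (2 * real j + 1)\<^sup>2)" for j
    using sin_cos_npi[of j] by (simp add: power2_eq_square mult_ac add_ac)
  ultimately show ?thesis by (simp add: sums_iff)
qed

text \<open>
  Both sides of the preceding identity are continuous in \<open>r\<close> up to \<open>r = 1\<close>: on the left because
  \<open>cos t \<ge> 0\<close> on the range of integration keeps the argument of the logarithm at least 1, on the
  right because the coefficients are absolutely summable.
\<close>

lemma has_integral_ln_2_plus_2cos:
  "((\<lambda>t. ln (2 + 2 * cos t)) has_integral 2 * catalan_constant) {0..pi / 2}"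
proof -
  define Q where "Q = (\<lambda>r. integral (cbox 0 (pi / 2)) (\<lambda>t. ln (1 + 2 * r * cos t + r\<^sup>2)))"
  define S where "S = (\<lambda>r. \<Sum>k. 2 * ((- 1) ^ k * r ^ (2 * k + 1) / (2 * real k + 1)\<^sup>2))"
  have pos: "1 + 2 * r * cos t + r\<^sup>2 > 0" if "r \<in> {0..1}" "t \<in> cbox 0 (pi / 2)" for r t
    using that cos_ge_zero[of t] by (simp add: add_pos_nonneg)
  have "continuous_on {0..1} Q"
    unfolding Q_def using pos
    by (intro integral_continuous_on_param) (force simp: case_prod_beta intro!: continuous_intros)
  moreover have "continuous_on {0..1} S"
    unfolding S_def
  proof (rule uniform_limit_theorem)
    show "uniform_limit {0..1} (\<lambda>n r. \<Sum>k<n. 2 * ((- 1) ^ k * r ^ (2 * k + 1) / (2 * real k + 1)\<^sup>2))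
        (\<lambda>r. \<Sum>k. 2 * ((- 1) ^ k * r ^ (2 * k + 1) / (2 * real k + 1)\<^sup>2)) sequentially"
    proof (rule Weierstrass_m_test)
      show "summable (\<lambda>k. 2 * (1 / (2 * real k + 1)\<^sup>2))"
        by (intro summable_mult summable_inverse_odd_sq)
      fix k and r :: real assume "r \<in> {0..1}"
      then show "norm (2 * ((- 1) ^ k * r ^ (2 * k + 1) / (2 * real k + 1)\<^sup>2)) \<le> 2 * (1 / (2 * real k + 1)\<^sup>2)"
        using power_le_one[of r "2 * k + 1"] by (simp add: abs_mult divide_right_mono)
    qed
  qed (auto intro!: always_eventually continuous_intros)
  ultimately have "continuous_on (closure {0..<1}) (\<lambda>r. Q r - S r)"
    by (auto intro: continuous_intros)
  then have "Q 1 - S 1 = 0"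
    by (rule continuous_constant_on_closure)
      (auto simp: Q_def S_def integral_ln_one_plus_2cos)
  moreover have "S 1 = 2 * catalan_constant"
  proof -
    have "summable (\<lambda>k. (- 1) ^ k * (1 / (2 * real k + 1)\<^sup>2))"
      by (rule summable_norm_cancel) (use summable_inverse_odd_sq in \<open>simp add: abs_mult\<close>)
    then show ?thesis using suminf_mult[of "\<lambda>k. (- 1) ^ k * (1 / (2 * real k + 1)\<^sup>2)" 2]
      by (simp add: S_def catalan_constant_def)
  qed
  moreover have "(\<lambda>t. ln (2 + 2 * cos t)) integrable_on {0..pi / 2}"
    using pos[of 1] by (intro integrable_continuous_real continuous_intros) force
  ultimately show ?thesis by (simp add: Q_def has_integral_iff)
qed

text \<open>
  The integrand is the generating function above at \<open>t\<close>, written with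
  \<open>ln (2 + 2 * cos t) = ln 2 + ln (1 + cos t)\<close>.
\<close>

lemma sums_wallis_ratio_sq_div:
  "(\<lambda>n. (wallis_ratio (Suc n))\<^sup>2 / (real n + 1)) sums (4 * ln 2 - 8 * catalan_constant / pi)"
proof -
  have "(\<lambda>n. wallis_ratio (Suc n) / (real n + 1) * (pi / 2 * wallis_ratio (Suc n)))
      sums (4 * ln 2 * (pi / 2) - 2 * (2 * catalan_constant))"
  proof (rule sums_has_integral_nonneg)
    show "((\<lambda>t. wallis_ratio (Suc n) / (real n + 1) * sin t ^ (2 * Suc n)) has_integral
        wallis_ratio (Suc n) / (real n + 1) * (pi / 2 * wallis_ratio (Suc n))) {0..pi / 2}" for n
      by (intro has_integral_mult_right has_integral_sin_power)
    have "((\<lambda>t. 4 * ln 2) has_integral 4 * ln 2 * (pi / 2)) {0..pi / 2}"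
      using has_integral_const_real[of "4 * ln 2 :: real" 0 "pi / 2"] by (simp add: mult_ac)
    then show "((\<lambda>t. 4 * ln 2 - 2 * ln (2 + 2 * cos t)) has_integral
        4 * ln 2 * (pi / 2) - 2 * (2 * catalan_constant)) {0..pi / 2}"
      by (intro has_integral_diff has_integral_mult_right has_integral_ln_2_plus_2cos)
  next
    fix t :: real assume t: "0 < t" "t < pi / 2"
    then have "ln (2 * (1 + cos t)) = ln 2 + ln (1 + cos t)"
      using cos_gt_zero[of t] by (intro ln_mult_pos) auto
    then show "(\<lambda>n. wallis_ratio (Suc n) / (real n + 1) * sin t ^ (2 * Suc n)) sums
        (4 * ln 2 - 2 * ln (2 + 2 * cos t))"
      using sums_wallis_ratio_sin_powser_div[of t] t by simp
    show "wallis_ratio (Suc n) / (real n + 1) * sin t ^ (2 * Suc n) \<ge> 0" for n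
      using wallis_ratio_pos[of "Suc n"] t sin_gt_zero[of t] by simp
  qed
  moreover have "2 / pi * (wallis_ratio (Suc n) / (real n + 1) * (pi / 2 * wallis_ratio (Suc n)))
      = (wallis_ratio (Suc n))\<^sup>2 / (real n + 1)" for n
    by (simp add: power2_eq_square field_simps)
  moreover have "2 / pi * (4 * ln 2 * (pi / 2) - 2 * (2 * catalan_constant)) = 4 * ln 2 - 8 * catalan_constant / pi"
    by (simp add: field_simps)
  ultimately show ?thesis
    using sums_mult[of _ "4 * ln 2 * (pi / 2) - 2 * (2 * catalan_constant)" "2 / pi"] by fastforce
qed

section \<open>Boundary terms\<close>

text \<open>The partial products in Wallis' formula are \<open>1 / ((2 * n + 1) * (wallis_ratio n)\<^sup>2)\<close>.\<close>

lemma wallis_ratio_sq_limit: "(\<lambda>n. real n * (wallis_ratio n)\<^sup>2) \<longlonglongrightarrow> 1 / pi"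
proof -
  have "(\<Prod>k=1..n. (4 * real k ^ 2) / (4 * real k ^ 2 - 1)) = 1 / ((2 * real n + 1) * (wallis_ratio n)\<^sup>2)" for n
  proof (induction n)
    case (Suc n)
    have eq: "4 * real (Suc n) ^ 2 - 1 = (2 * real n + 1) * (2 * real n + 3)"
      by (simp add: power2_eq_square algebra_simps)
    have "(\<Prod>k=1..Suc n. (4 * real k ^ 2) / (4 * real k ^ 2 - 1))
        = 1 / ((2 * real n + 1) * (wallis_ratio n)\<^sup>2) * (4 * real (Suc n) ^ 2 / (4 * real (Suc n) ^ 2 - 1))"
      unfolding Suc [symmetric] by simp
    also have "\<dots> = 1 / ((2 * real (Suc n) + 1) * (wallis_ratio (Suc n))\<^sup>2)"
      unfolding eq wallis_ratio_Suc_sq using wallis_ratio_pos[of n]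
      by (simp add: divide_simps) (simp add: algebra_simps power2_eq_square)
    finally show ?case .
  qed simp
  with wallis have "(\<lambda>n. 1 / ((2 * real n + 1) * (wallis_ratio n)\<^sup>2)) \<longlonglongrightarrow> pi / 2"
    by simp
  then have "(\<lambda>n. inverse (1 / ((2 * real n + 1) * (wallis_ratio n)\<^sup>2))) \<longlonglongrightarrow> inverse (pi / 2)"
    by (rule tendsto_inverse) simp
  moreover have "(\<lambda>n. real n / (2 * real n + 1)) \<longlonglongrightarrow> 1 / 2"
    by real_asymp
  ultimately have "(\<lambda>n. inverse (1 / ((2 * real n + 1) * (wallis_ratio n)\<^sup>2)) * (real n / (2 * real n + 1)))
      \<longlonglongrightarrow> inverse (pi / 2) * (1 / 2)"
    by (rule tendsto_mult)
  moreover have "inverse (1 / ((2 * real n + 1) * (wallis_ratio n)\<^sup>2)) * (real n / (2 * real n + 1))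
      = real n * (wallis_ratio n)\<^sup>2" for n
    by simp
  ultimately show ?thesis by (simp add: mult_ac)
qed

lemma wallis_ratio_sq_tendsto_0: "(\<lambda>n. (wallis_ratio n)\<^sup>2) \<longlonglongrightarrow> 0"
proof -
  have "(\<lambda>n. real n * (wallis_ratio n)\<^sup>2 * (1 / real n)) \<longlonglongrightarrow> 1 / pi * 0"
    by (intro tendsto_mult wallis_ratio_sq_limit) real_asymp
  then have "(\<lambda>n. real n * (wallis_ratio n)\<^sup>2 * (1 / real n)) \<longlonglongrightarrow> 0" by simp
  then show ?thesis
    by (rule Lim_transform_eventually)
      (use eventually_gt_at_top[of "0::nat"] in \<open>auto elim!: eventually_mono\<close>)
qed

text \<open>
  The two sequences approach their common limit \<open>1 / pi\<close> monotonically, the first from below and the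
  second from above, so each is bounded by it. Their gap gives the rate of convergence.
\<close>

lemma wallis_ratio_sq_bounds:
  "real n * (wallis_ratio n)\<^sup>2 \<le> 1 / pi" "1 / pi \<le> (real n + 1 / 2) * (wallis_ratio n)\<^sup>2"
proof -
  have "incseq (\<lambda>n. real n * (wallis_ratio n)\<^sup>2)"
  proof (rule incseq_SucI)
    fix n
    have "real n \<le> (2 * real n + 1)\<^sup>2 / (4 * (real n + 1))"
      by (simp add: field_simps power2_eq_square)
    from mult_right_mono[OF this, of "(wallis_ratio n)\<^sup>2"]
    have "real n * (wallis_ratio n)\<^sup>2 \<le> (2 * real n + 1)\<^sup>2 / (4 * (real n + 1)) * (wallis_ratio n)\<^sup>2"
      by simp
    also have "\<dots> = real (Suc n) * (wallis_ratio (Suc n))\<^sup>2"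
      unfolding wallis_ratio_Suc_sq by (simp add: divide_simps) (simp add: algebra_simps power2_eq_square)
    finally show "real n * (wallis_ratio n)\<^sup>2 \<le> real (Suc n) * (wallis_ratio (Suc n))\<^sup>2" .
  qed
  then show "real n * (wallis_ratio n)\<^sup>2 \<le> 1 / pi"
    using wallis_ratio_sq_limit by (rule incseq_le)
  have "decseq (\<lambda>n. (real n + 1 / 2) * (wallis_ratio n)\<^sup>2)"
  proof (rule decseq_SucI)
    fix n
    have "(real n + 3 / 2) * ((2 * real n + 1)\<^sup>2 / (4 * (real n + 1)\<^sup>2)) \<le> real n + 1 / 2"
      by (simp add: divide_simps) (simp add: algebra_simps power2_eq_square)
    from mult_right_mono[OF this, of "(wallis_ratio n)\<^sup>2"]
    show "(real (Suc n) + 1 / 2) * (wallis_ratio (Suc n))\<^sup>2 \<le> (real n + 1 / 2) * (wallis_ratio n)\<^sup>2"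
      by (simp add: wallis_ratio_Suc_sq mult_ac add_ac)
  qed
  moreover have "(\<lambda>n. (real n + 1 / 2) * (wallis_ratio n)\<^sup>2) \<longlonglongrightarrow> 1 / pi"
  proof -
    have "(\<lambda>n. real n * (wallis_ratio n)\<^sup>2 + 1 / 2 * (wallis_ratio n)\<^sup>2) \<longlonglongrightarrow> 1 / pi + 1 / 2 * 0"
      by (intro tendsto_intros wallis_ratio_sq_limit wallis_ratio_sq_tendsto_0)
    then show ?thesis by (simp add: algebra_simps)
  qed
  ultimately show "1 / pi \<le> (real n + 1 / 2) * (wallis_ratio n)\<^sup>2"
    by (rule decseq_ge)
qed

lemma harm_double_Suc:
  "harm (2 * Suc n) = (harm (2 * n) + 1 / (2 * real n + 1) + 1 / (real n + 1) / 2 :: real)"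
  by (simp add: harm_Suc inverse_eq_divide add_ac)

lemma harm_double_minus_harm_tendsto: "(\<lambda>n. harm (2 * n) - harm n :: real) \<longlonglongrightarrow> ln 2"
proof -
  have "(\<Sum>k<n. inverse (real (2 * k + 1)) - inverse (real (2 * k + 2))) = harm (2 * n) - harm n" for n
  proof (induction n)
    case (Suc n)
    have "inverse (real (2 * n + 1)) = 1 / (2 * real n + 1)" "inverse (real (2 * n + 2)) = 1 / (real n + 1) / 2"
      "inverse (real (Suc n)) = 1 / (real n + 1)"
      by (simp_all add: field_simps)
    then show ?case
      unfolding sum.lessThan_Suc Suc harm_double_Suc harm_Suc[of n] by linarith
  qed (simp add: harm_expand)
  then show ?thesis
    using alternating_harmonic_series_sums' by (simp add: sums_def)
qed

lemma sum_inverse_odd: "(\<Sum>k<n. 1 / (2 * real k + 1)) = harm (2 * n) - harm n / 2"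
proof (induction n)
  case (Suc n)
  show ?case
    unfolding sum.lessThan_Suc Suc harm_double_Suc harm_Suc[of n]
    by (simp add: inverse_eq_divide add.commute[of 1] add_divide_distrib)
qed (simp add: harm_expand)

text \<open>
  Although \<open>harm (2 * n)\<close> is unbounded, it grows only logarithmically, and the preceding bounds show
  that the factor in front of it is \<open>O(1 / n)\<close>.
\<close>

lemma harm_wallis_error_tendsto_0:
  "(\<lambda>n. (real n * (wallis_ratio n)\<^sup>2 - 1 / pi) * harm (2 * n)) \<longlonglongrightarrow> 0"
proof (rule Lim_null_comparison)
  have lim: "(\<lambda>n. harm n / real n) \<longlonglongrightarrow> (0::real)"
  proof -
    have "(\<lambda>n. (harm n - ln (real n)) * (1 / real n) + ln (real n) / real n) \<longlonglongrightarrow> euler_mascheroni * 0 + 0"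
      by (intro tendsto_add tendsto_mult euler_mascheroni_LIMSEQ) real_asymp+
    then show ?thesis by (simp add: diff_divide_distrib)
  qed
  have "filterlim (\<lambda>n::nat. 2 * n) sequentially sequentially"
    by (rule mult_nat_left_at_top) simp
  from tendsto_mult[OF filterlim_compose[OF lim this] tendsto_const[of "1 / pi"]]
  show "(\<lambda>n. harm (2 * n) / real (2 * n) * (1 / pi)) \<longlonglongrightarrow> (0::real)" by simp
  show "\<forall>\<^sub>F n in sequentially. norm ((real n * (wallis_ratio n)\<^sup>2 - 1 / pi) * harm (2 * n))
      \<le> harm (2 * n) / real (2 * n) * (1 / pi)"
    using eventually_gt_at_top[of "0::nat"]
  proof eventually_elim
    case (elim n)
    have "\<bar>real n * (wallis_ratio n)\<^sup>2 - 1 / pi\<bar> \<le> (wallis_ratio n)\<^sup>2 / 2"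
      using wallis_ratio_sq_bounds[of n] by (simp add: algebra_simps)
    also have "\<dots> \<le> 1 / (2 * real n * pi)"
      using wallis_ratio_sq_bounds(1)[of n] elim by (simp add: field_simps)
    finally have "\<bar>real n * (wallis_ratio n)\<^sup>2 - 1 / pi\<bar> * harm (2 * n) \<le> 1 / (2 * real n * pi) * harm (2 * n)"
      by (intro mult_right_mono) (auto intro: harm_nonneg)
    moreover have "1 / (2 * real n * pi) * harm (2 * n) = harm (2 * n) / real (2 * n) * (1 / pi)"
      by simp
    ultimately show ?case
      by (simp only: real_norm_def abs_mult abs_of_nonneg[OF harm_nonneg])
  qed
qed

section \<open>Summation by parts\<close>

text \<open>
  Summation by parts with \<open>(wallis_ratio n)\<^sup>2 / (n + 1)\<close> as the difference of
  \<open>T n = 4 * n * (wallis_ratio n)\<^sup>2\<close>. The increment of \<open>harm (2 * n)\<close> times \<open>T (n + 1)\<close> is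
  \<open>(4 - 3 / (n + 1) + 1 / (2 * (n + 1)\<^sup>2)) * (wallis_ratio n)\<^sup>2\<close>, where the last two summands
  are again differences, since \<open>(wallis_ratio n)\<^sup>2 / (n + 1)\<^sup>2\<close> is the difference of
  \<open>4 * (4 * n + 1) * (wallis_ratio n)\<^sup>2\<close>. The resulting closed form is verified by induction.
\<close>

lemma sum_harm_wallis_ratio_sq:
  "(\<Sum>n<N. (wallis_ratio n)\<^sup>2 * harm (2 * n) / (real n + 1))
    = 4 * real N * (wallis_ratio N)\<^sup>2 * harm (2 * N) - 4 * (\<Sum>n<N. (wallis_ratio n)\<^sup>2)
      + (4 * real N - 2) * (wallis_ratio N)\<^sup>2 + 2"
proof (induction N)
  case (Suc N)
  \<comment> \<open>The induction step as an identity of rational functions, with \<open>x\<close> for \<open>N\<close>, \<open>v\<close> for the ratio,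
      \<open>h\<close> for the harmonic number and \<open>S\<close> for the remaining sum.\<close>
  have "4 * x * v\<^sup>2 * h - 4 * S + (4 * x - 2) * v\<^sup>2 + 2 + v\<^sup>2 * h / (x + 1)
      = 4 * (x + 1) * ((2 * x + 1)\<^sup>2 / (4 * (x + 1)\<^sup>2) * v\<^sup>2) * (h + 1 / (2 * x + 1) + 1 / (x + 1) / 2)
        - 4 * (S + v\<^sup>2) + (4 * (x + 1) - 2) * ((2 * x + 1)\<^sup>2 / (4 * (x + 1)\<^sup>2) * v\<^sup>2) + 2"
    if "x \<ge> 0" for x v h S :: real
    using that by (simp add: divide_simps) (simp add: algebra_simps power2_eq_square)
  from this[of "real N" "wallis_ratio N" "harm (2 * N)" "\<Sum>n<N. (wallis_ratio n)\<^sup>2"] show ?case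
    unfolding sum.lessThan_Suc Suc wallis_ratio_Suc_sq[of N] harm_double_Suc[of N] of_nat_Suc
    by (simp only: add.commute[of 1] of_nat_0_le_iff)
qed (simp add: harm_expand)

text \<open>
  Here the first factor is the difference of \<open>- (16 * n + 8) * (wallis_ratio n)\<^sup>2\<close>. The
  increment of \<open>harm (2 * n) - harm n\<close> is \<open>1 / ((2 * n + 1) * (2 * n + 2))\<close>, and summation by parts
  leaves \<open>(4 / (n + 1) - 1 / (n + 1) ^ 3) * (wallis_ratio n)\<^sup>2\<close>. The cubic part equals
  \<open>4 * (wallis_ratio (n + 1))\<^sup>2 / (n + 1)\<close> plus the difference of \<open>(48 * n + 16) * (wallis_ratio n)\<^sup>2\<close>.
\<close>

lemma sum_harm_diff_wallis_ratio_sq: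
  "(\<Sum>n<N. 2 * (2 * real n + 1) / (real n + 1)\<^sup>2 * (wallis_ratio n)\<^sup>2 * (harm (2 * n) - harm n))
    = - (harm (2 * N) - harm N) * (16 * real N + 8) * (wallis_ratio N)\<^sup>2
      - (32 * real N + 16) * (wallis_ratio N)\<^sup>2 + 16
      - 4 * (\<Sum>n<N. (wallis_ratio (Suc n))\<^sup>2 / (real n + 1))"
proof (induction N)
  case (Suc N)
  \<comment> \<open>As before, with \<open>h\<close> and \<open>k\<close> for the two harmonic numbers.\<close>
  have "- (h - k) * (16 * x + 8) * v\<^sup>2 - (32 * x + 16) * v\<^sup>2 + 16 - 4 * S
        + 2 * (2 * x + 1) / (x + 1)\<^sup>2 * v\<^sup>2 * (h - k)
      = - (h + 1 / (2 * x + 1) + 1 / (x + 1) / 2 - (k + 1 / (x + 1))) * (16 * (x + 1) + 8)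
          * ((2 * x + 1)\<^sup>2 / (4 * (x + 1)\<^sup>2) * v\<^sup>2)
        - (32 * (x + 1) + 16) * ((2 * x + 1)\<^sup>2 / (4 * (x + 1)\<^sup>2) * v\<^sup>2) + 16
        - 4 * (S + (2 * x + 1)\<^sup>2 / (4 * (x + 1)\<^sup>2) * v\<^sup>2 / (x + 1))"
    if "x \<ge> 0" for x v h k S :: real
    using that by (simp add: divide_simps) (simp add: algebra_simps power2_eq_square)
  from this[of "real N" "harm (2 * N)" "harm N" "wallis_ratio N"
      "\<Sum>n<N. (wallis_ratio (Suc n))\<^sup>2 / (real n + 1)"]
  show ?case
    unfolding sum.lessThan_Suc Suc wallis_ratio_Suc_sq[of N] harm_double_Suc[of N] harm_Suc[of N] of_nat_Suc
    by (simp only: add.commute[of 1] of_nat_0_le_iff inverse_eq_divide)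
qed (simp add: harm_expand)

theorem theorem2p4:
  shows "(\<lambda>m. let n = Suc m in
            catalan_number n * (harm (2 * n) - harm n) / 4 ^ (2 * n)
              * real ((2 * n + 2) choose (n + 1)))
         sums (16 / pi * (2 * catalan_constant + pi - 2 - ln 2 - pi * ln 2))
       \<and> (\<lambda>m. let n = Suc m in
            catalan_number n * harm (2 * n) / 16 ^ n * real ((2 * n) choose n))
         sums (2 / pi * (2 + pi - 2 * ln 8))"
proof
  note lims = tendsto_intros wallis_ratio_sq_limit wallis_ratio_sq_tendsto_0 harm_double_minus_harm_tendsto
  have choose: "real ((2 * n) choose n) = 4 ^ n * wallis_ratio n" for n
    by (simp add: wallis_ratio_def)
  have four: "(4::real) ^ (2 * n) = 4 ^ n * 4 ^ n" "(16::real) ^ n = 4 ^ n * 4 ^ n" for n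
    by (simp_all add: mult_2 power_add flip: power_mult_distrib)
  let ?f = "\<lambda>n. 2 * (2 * real n + 1) / (real n + 1)\<^sup>2 * (wallis_ratio n)\<^sup>2 * (harm (2 * n) - harm n)"
  let ?g = "\<lambda>n. (wallis_ratio n)\<^sup>2 * harm (2 * n) / (real n + 1)"
  have f: "catalan_number n * (harm (2 * n) - harm n) / 4 ^ (2 * n)
      * real ((2 * n + 2) choose (n + 1)) = ?f n" for n
  proof -
    have "2 * n + 2 = 2 * Suc n" "n + 1 = Suc n" by simp_all
    then have "real ((2 * n + 2) choose (n + 1)) = 4 ^ Suc n * wallis_ratio (Suc n)"
      by (simp only: choose)
    then show ?thesis
      by (simp only: catalan_number_def choose four wallis_ratio_Suc)
        (simp add: divide_simps power2_eq_square, simp add: algebra_simps)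
  qed
  have g: "catalan_number n * harm (2 * n) / 16 ^ n * real ((2 * n) choose n) = ?g n" for n
    by (simp add: catalan_number_def choose four divide_simps power2_eq_square)

  have "(\<lambda>N. - (harm (2 * N) - harm N) * (16 * (real N * (wallis_ratio N)\<^sup>2) + 8 * (wallis_ratio N)\<^sup>2)
      - (32 * (real N * (wallis_ratio N)\<^sup>2) + 16 * (wallis_ratio N)\<^sup>2) + 16
      - 4 * (\<Sum>n<N. (wallis_ratio (Suc n))\<^sup>2 / (real n + 1)))
    \<longlonglongrightarrow> - ln 2 * (16 * (1 / pi) + 8 * 0) - (32 * (1 / pi) + 16 * 0) + 16
        - 4 * (4 * ln 2 - 8 * catalan_constant / pi)"
    using sums_wallis_ratio_sq_div unfolding sums_def by (intro lims)
  also have "- ln 2 * (16 * (1 / pi) + 8 * 0) - (32 * (1 / pi) + 16 * 0) + 16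
        - 4 * (4 * ln 2 - 8 * catalan_constant / pi)
      = 16 / pi * (2 * catalan_constant + pi - 2 - ln 2 - pi * ln 2)"
    by (simp add: field_simps)
  also have "(\<lambda>N. - (harm (2 * N) - harm N) * (16 * (real N * (wallis_ratio N)\<^sup>2) + 8 * (wallis_ratio N)\<^sup>2)
      - (32 * (real N * (wallis_ratio N)\<^sup>2) + 16 * (wallis_ratio N)\<^sup>2) + 16
      - 4 * (\<Sum>n<N. (wallis_ratio (Suc n))\<^sup>2 / (real n + 1))) = (\<lambda>N. \<Sum>n<N. ?f n)"
    unfolding sum_harm_diff_wallis_ratio_sq by (simp add: algebra_simps)
  finally have "?f sums (16 / pi * (2 * catalan_constant + pi - 2 - ln 2 - pi * ln 2))"
    unfolding sums_def .
  \<comment> \<open>The term at \<open>n = 0\<close> vanishes because \<open>harm 0 = 0\<close>.\<close>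
  then have "(\<lambda>m. ?f (Suc m)) sums (16 / pi * (2 * catalan_constant + pi - 2 - ln 2 - pi * ln 2))"
    by (subst sums_Suc_iff) (simp add: harm_expand)
  then show "(\<lambda>m. let n = Suc m in
            catalan_number n * (harm (2 * n) - harm n) / 4 ^ (2 * n)
              * real ((2 * n + 2) choose (n + 1)))
         sums (16 / pi * (2 * catalan_constant + pi - 2 - ln 2 - pi * ln 2))"
    unfolding Let_def f .

  \<comment> \<open>The divergent sum of squares is split into its comparison series, which is a combination of
      harmonic numbers, and a convergent rest. The coefficient of \<open>harm (2 * N)\<close> is then exactly the
      error \<open>real N * (wallis_ratio N)\<^sup>2 - 1 / pi\<close>, and the other harmonic numbers combine to
      \<open>harm (2 * N) - harm N\<close>.\<close>
  have "(\<lambda>N. 4 * ((real N * (wallis_ratio N)\<^sup>2 - 1 / pi) * harm (2 * N)) - 4 / pi * (harm (2 * N) - harm N)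
      - 4 * (\<Sum>n<N. (wallis_ratio n)\<^sup>2 - 2 / pi / (2 * real n + 1))
      + (4 * (real N * (wallis_ratio N)\<^sup>2) - 2 * (wallis_ratio N)\<^sup>2) + 2)
    \<longlonglongrightarrow> 4 * 0 - 4 / pi * ln 2 - 4 * (2 / pi * ln 2) + (4 * (1 / pi) - 2 * 0) + 2"
    using sums_wallis_ratio_sq_minus unfolding sums_def
    by (intro lims harm_wallis_error_tendsto_0)
  also have "4 * 0 - 4 / pi * ln 2 - 4 * (2 / pi * ln 2) + (4 * (1 / pi) - 2 * 0) + 2
      = 2 / pi * (2 + pi - 2 * ln 8)"
    using ln_realpow[of 2 3] by (simp add: field_simps)
  also have "(\<lambda>N. 4 * ((real N * (wallis_ratio N)\<^sup>2 - 1 / pi) * harm (2 * N)) - 4 / pi * (harm (2 * N) - harm N)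
      - 4 * (\<Sum>n<N. (wallis_ratio n)\<^sup>2 - 2 / pi / (2 * real n + 1))
      + (4 * (real N * (wallis_ratio N)\<^sup>2) - 2 * (wallis_ratio N)\<^sup>2) + 2) = (\<lambda>N. \<Sum>n<N. ?g n)"
  proof
    fix N
    have odd: "(\<Sum>n<N. 2 / pi / (2 * real n + 1)) = 2 / pi * (harm (2 * N) - harm N / 2)"
      unfolding sum_inverse_odd [symmetric] by (simp add: sum_distrib_left)
    show "4 * ((real N * (wallis_ratio N)\<^sup>2 - 1 / pi) * harm (2 * N)) - 4 / pi * (harm (2 * N) - harm N)
      - 4 * (\<Sum>n<N. (wallis_ratio n)\<^sup>2 - 2 / pi / (2 * real n + 1))
      + (4 * (real N * (wallis_ratio N)\<^sup>2) - 2 * (wallis_ratio N)\<^sup>2) + 2 = (\<Sum>n<N. ?g n)"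
      unfolding sum_harm_wallis_ratio_sq sum_subtractf odd by (simp add: field_simps)
  qed
  finally have "?g sums (2 / pi * (2 + pi - 2 * ln 8))"
    unfolding sums_def .
  then have "(\<lambda>m. ?g (Suc m)) sums (2 / pi * (2 + pi - 2 * ln 8))"
    by (subst sums_Suc_iff) (simp add: harm_expand)
  then show "(\<lambda>m. let n = Suc m in
            catalan_number n * harm (2 * n) / 16 ^ n * real ((2 * n) choose n))
         sums (2 / pi * (2 + pi - 2 * ln 8))"
    unfolding Let_def g .
qed

end
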